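(* Let $f:\mathbb{R}^2\to\mathbb{R}$ be any function and define $$E=\bigl\{x\in\mathbb{R}^2: f\text{ is Lipschitz at }x\text{ in residual many directions}\bigr\}.$$ Then the set $$F=\bigl\{x\in E: f\text{ is not Lipschitz at }x\text{ relative to }E\bigr\}$$ is $\sigma$-porous.
   Context: Notation: $\|\cdot\|$ is the Euclidean norm on $\mathbb{R}^d$, $\mathbb{S}^{d-1}$ is the corresponding unit sphere, and $B(x,r)$ is the open ball with center $x$ and radius $r>0$. Directional Lipschitz property: let $G\subset\mathbb{R}^d$ be open, $f:G\to\mathbb{R}$ a function, $x\in G$ and $u\in\mathbb{S}^{d-1}$. We say that $f$ is Lipschitz at $x$ in direction $u$ if $$\limsup_{h\to0+}\frac{|f(x+hu)-f(x)|}{h}<\infty.$$ We say that $f$ is Lipschitz at $x$ in residual many directions if the set $\{u\in\mathbb{S}^{d-1}: f\text{ is not Lipschitz at }x\text{ in direction }u\}$ is of the first Baire category (meager) in $\mathbb{S}^{d-1}$. Relative Lipschitz property: for $M\subset G$ and $x\in G$, we say that $f$ is Lipschitz at $x$ relative to $M$ if $x$ is not a limit point of $M$ or $$\limsup_{y\to x,\,y\in M}\frac{|f(y)-f(x)|}{\|y-x\|}<\infty$$ (the limsup is over $y\neq x$). Porosity: a set $A\subset\mathbb{R}^d$ is porous at $x\in\mathbb{R}^d$ if there is $0<p<1$ such that for every $\varepsilon>0$ there exists $y\in B(x,\varepsilon)$ with $y\neq x$ and $B(y,p\|x-y\|)\cap A=\emptyset$. The set $A$ is porous if it is porous at $x$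 for all $x\in A$. A subset of $\mathbb{R}^d$ is $\sigma$-porous if it is a countable union of porous sets. *)

theory Defs
  imports "HOL-Analysis.Analysis"
begin

definition nowhere_dense_in :: "'a topology \<Rightarrow> 'a set \<Rightarrow> bool" where
  "nowhere_dense_in X N \<longleftrightarrow> N \<subseteq> topspace X \<and> X interior_of (X closure_of N) = {}"

definition meager_in :: "'a topology \<Rightarrow> 'a set \<Rightarrow> bool" where
  "meager_in X A \<longleftrightarrow>
     (\<exists>\<N>. countable \<N> \<and> (\<forall>N\<in>\<N>. nowhere_dense_in X N) \<and> A = \<Union>\<N>)"

text \<open>
  The limits superior are taken in the extended reals, since the difference quotients may be
  unbounded. Functions are total; the notions below only depend on the values of \<open>f\<close> near \<open>x\<close>,
  so for functions on an open set no domain parameter is needed.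
\<close>

definition lipschitz_at_dir ::
    "('a::euclidean_space \<Rightarrow> real) \<Rightarrow> 'a \<Rightarrow> 'a \<Rightarrow> bool" where
  "lipschitz_at_dir f x u \<longleftrightarrow>
     Limsup (at_right 0) (\<lambda>h. ereal (\<bar>f (x + h *\<^sub>R u) - f x\<bar> / h)) < \<infinity>"

definition lipschitz_at_residual_dirs ::
    "('a::euclidean_space \<Rightarrow> real) \<Rightarrow> 'a \<Rightarrow> bool" where
  "lipschitz_at_residual_dirs f x \<longleftrightarrow>
     meager_in (top_of_set (sphere 0 1)) {u \<in> sphere 0 1. \<not> lipschitz_at_dir f x u}"

text \<open>The filter \<open>at x within M\<close> excludes the point \<open>x\<close> itself.\<close>

definition lipschitz_at_relative ::
    "('a::euclidean_space \<Rightarrow> real) \<Rightarrow> 'a \<Rightarrow> 'a set \<Rightarrow> bool" where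
  "lipschitz_at_relative f x M \<longleftrightarrow>
     \<not> x islimpt M \<or>
     Limsup (at x within M) (\<lambda>y. ereal (\<bar>f y - f x\<bar> / norm (y - x))) < \<infinity>"

definition porous_at :: "'a::euclidean_space set \<Rightarrow> 'a \<Rightarrow> bool" where
  "porous_at A x \<longleftrightarrow>
     (\<exists>p::real. 0 < p \<and> p < 1 \<and>
        (\<forall>\<epsilon>>0. \<exists>y\<in>ball x \<epsilon>. y \<noteq> x \<and> ball y (p * norm (x - y)) \<inter> A = {}))"

definition porous :: "'a::euclidean_space set \<Rightarrow> bool" where
  "porous A \<longleftrightarrow> (\<forall>x\<in>A. porous_at A x)"

definition sigma_porous :: "'a::euclidean_space set \<Rightarrow> bool" where
  "sigma_porous A \<longleftrightarrow> (\<exists>\<P>. countable \<P> \<and> (\<forall>P\<in>\<P>. porous P) \<and> A = \<Union>\<P>)"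

end

theory Submission
  imports Defs
begin

text \<open>
  By the Baire category theorem, every \<open>x \<in> E\<close> has, for some \<open>n\<close> and some basic open \<open>B\<close>, a set of
  directions dense in the arc \<open>B \<inter> S\<^sup>1\<close> along which \<open>f\<close> is \<open>n\<close>-Lipschitz at \<open>x\<close> up to
  distance \<open>1/n\<close>; this splits \<open>F\<close> into countably many pieces. If \<open>y\<close> lies in the piece of
  \<open>n, B\<close>, and \<open>z \<in> E\<close> is near \<open>y\<close> and seen from \<open>y\<close> in a direction of \<open>B\<close>, then good rays from \<open>y\<close>
  cross a Lipschitz ray issuing from \<open>z\<close> arbitrarily close to \<open>z\<close>, so
  \<open>\<bar>f z - f y\<bar> \<le> n \<parallel>z - y\<parallel>\<close>. If the piece is not porous at its point \<open>x\<close>, then for every \<open>z \<in> E\<close>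
  near \<open>x\<close> it contains a \<open>y\<close>, at distance comparable to \<open>\<parallel>z - x\<parallel>\<close>, from which both \<open>x\<close> and \<open>z\<close> are
  seen in directions of \<open>B\<close>. Hence \<open>f\<close> is Lipschitz at \<open>x\<close> relative to \<open>E\<close>.
\<close>

section \<open>Baire category and countably many uniform pieces\<close>

text \<open>Relative to \<open>S\<close>, the complement of the closure of a nowhere dense set is
  open and dense, so the Baire theorem on the closed set \<open>S\<close> makes the intersection of
  these complements dense.\<close>

lemma dense_diff_meager:
  fixes S :: "'a::euclidean_space set"
  assumes "closed S" and "meager_in (top_of_set S) M"
  shows "S \<subseteq> closure (S - M)"
proof -
  from assms(2) obtain \<N> where N: "countable \<N>" "\<And>N. N \<in> \<N> \<Longrightarrow> nowhere_dense_in (top_of_set S) N"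
      "M = \<Union>\<N>"
    unfolding meager_in_def by blast
  define \<G> where "\<G> = (\<lambda>N. S - top_of_set S closure_of N) ` \<N>"
  have "openin (top_of_set S) T \<and> S \<subseteq> closure T" if "T \<in> \<G>" for T
  proof -
    from that obtain N where "N \<in> \<N>" and T: "T = S - top_of_set S closure_of N"
      unfolding \<G>_def by blast
    then have "top_of_set S interior_of (top_of_set S closure_of N) = {}"
      using N(2) unfolding nowhere_dense_in_def by blast
    then have "top_of_set S closure_of T = S"
      unfolding T using closure_of_complement[of "top_of_set S" "top_of_set S closure_of N"] by simp
    then have "S \<subseteq> closure T"
      by (metis closure_of_subtopology_subset euclidean_closure_of)
    moreover have "openin (top_of_set S) T"
      unfolding T by (metis closedin_closure_of openin_diff openin_topspace topspace_euclidean_subtopology)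
    ultimately show ?thesis by blast
  qed
  moreover have "countable \<G>"
    unfolding \<G>_def using N(1) by blast
  ultimately have "S \<subseteq> closure (\<Inter>\<G>)"
    using Baire[OF assms(1)] by blast
  show ?thesis
  \<comment> \<open>The intersection of an empty family is \<open>UNIV\<close>, which need not lie
    in \<open>S\<close>.\<close>
  proof (cases "\<N> = {}")
    case True
    then show ?thesis using N(3) closure_subset by auto
  next
    case False
    have "\<Inter>\<G> \<subseteq> S - M"
    proof
      fix x assume x: "x \<in> \<Inter>\<G>"
      then have "x \<in> S" using False unfolding \<G>_def by blast
      moreover have "x \<notin> N" if "N \<in> \<N>" for N
      proof
        assume "x \<in> N"
        have "N \<subseteq> top_of_set S closure_of N"
          by (meson N(2) closure_of_subset nowhere_dense_in_def that)
        then show False using x that \<open>x \<in> N\<close> unfolding \<G>_def by blast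
      qed
      ultimately show "x \<in> S - M" using N(3) by blast
    qed
    then show ?thesis using \<open>S \<subseteq> closure (\<Inter>\<G>)\<close> closure_mono by blast
  qed
qed

text \<open>\<open>n\<close> serves both as Lipschitz constant and as inverse range. The form
  \<open>real n * h < 1\<close> avoids a division by zero: for \<open>n = 0\<close> every
  \<open>h > 0\<close> is allowed.\<close>

definition uniform_dirs :: "('a::euclidean_space \<Rightarrow> real) \<Rightarrow> nat \<Rightarrow> 'a \<Rightarrow> 'a set" where
  "uniform_dirs f n x =
     {u \<in> sphere 0 1. \<forall>h>0. real n * h < 1 \<longrightarrow> \<bar>f (x + h *\<^sub>R u) - f x\<bar> \<le> real n * h}"

text \<open>The first conjunct rules out sets \<open>B\<close> missing the sphere, for which the
  inclusion would be vacuous.\<close>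

definition piece :: "('a::euclidean_space \<Rightarrow> real) \<Rightarrow> nat \<Rightarrow> 'a set \<Rightarrow> 'a set" where
  "piece f n B = {x. B \<inter> sphere 0 1 \<noteq> {} \<and> B \<inter> sphere 0 1 \<subseteq> closure (uniform_dirs f n x)}"

lemma lipschitz_at_dirD:
  assumes "lipschitz_at_dir f x u"
  obtains C b where "C > 0" "b > 0" "\<And>h. 0 < h \<Longrightarrow> h < b \<Longrightarrow> \<bar>f (x + h *\<^sub>R u) - f x\<bar> \<le> C * h"
proof -
  let ?q = "\<lambda>h. ereal (\<bar>f (x + h *\<^sub>R u) - f x\<bar> / h)"
  from assms obtain C where C: "Limsup (at_right 0) ?q < ereal C"
    unfolding lipschitz_at_dir_def using less_PInf_Ex_of_nat by force
  have "\<forall>\<^sub>F h in at_right 0. ?q h < ereal C"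
    using C by (rule Limsup_lessD)
  then obtain b where "b > 0" and b: "\<And>h. 0 < h \<Longrightarrow> h < b \<Longrightarrow> ?q h < ereal C"
    unfolding eventually_at_right_field by auto
  show thesis
  proof (rule that[of "max 1 C" b])
    fix h :: real assume h: "0 < h" "h < b"
    then have "\<bar>f (x + h *\<^sub>R u) - f x\<bar> \<le> C * h"
      using b[OF h] by (simp add: divide_simps)
    also have "\<dots> \<le> max 1 C * h"
      using h by (intro mult_right_mono) auto
    finally show "\<bar>f (x + h *\<^sub>R u) - f x\<bar> \<le> max 1 C * h" .
  qed (use \<open>b > 0\<close> in auto)
qed

lemma lipschitz_dir_in_uniform_dirs:
  assumes "lipschitz_at_dir f x u" "u \<in> sphere 0 1"
  shows "\<exists>n. u \<in> uniform_dirs f n x"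
proof -
  obtain C b where Cb: "C > 0" "b > 0" "\<And>h. 0 < h \<Longrightarrow> h < b \<Longrightarrow> \<bar>f (x + h *\<^sub>R u) - f x\<bar> \<le> C * h"
    using lipschitz_at_dirD[OF assms(1)] by blast
  obtain n :: nat where n: "real n > max C (1 / b)"
    using reals_Archimedean2 by blast
  have "\<bar>f (x + h *\<^sub>R u) - f x\<bar> \<le> real n * h" if "h > 0" "real n * h < 1" for h
  proof -
    have "1 / b * h < 1"
      using n that by (smt (verit) mult_right_mono max.cobounded2)
    then have "h < b"
      using Cb(2) by (simp add: divide_simps)
    then have "\<bar>f (x + h *\<^sub>R u) - f x\<bar> \<le> C * h"
      using Cb(3) that by blast
    also have "\<dots> \<le> real n * h"
      using n that by (intro mult_right_mono) auto
    finally show ?thesis .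
  qed
  then show ?thesis
    using assms(2) unfolding uniform_dirs_def by blast
qed

text \<open>The bad directions and the sets \<open>uniform_dirs f n x\<close> cover the sphere. Were
  all the latter nowhere dense, the sphere would be meager in itself.\<close>

lemma residual_dirs_in_piece:
  fixes f :: "'a::euclidean_space \<Rightarrow> real"
  assumes "lipschitz_at_residual_dirs f x" and "topological_basis \<B>"
  obtains n B where "B \<in> \<B>" "x \<in> piece f n B"
proof -
  let ?S = "sphere (0::'a) 1"
  let ?X = "top_of_set ?S"
  define Bad where "Bad = {u \<in> ?S. \<not> lipschitz_at_dir f x u}"
  obtain \<N> where N: "countable \<N>" "\<And>N. N \<in> \<N> \<Longrightarrow> nowhere_dense_in ?X N" "Bad = \<Union>\<N>"
    using assms(1) unfolding lipschitz_at_residual_dirs_def meager_in_def Bad_def by blast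
  have "\<exists>n. \<not> nowhere_dense_in ?X (uniform_dirs f n x)"
  proof (rule ccontr)
    assume "\<not> ?thesis"
    then have *: "\<And>n. nowhere_dense_in ?X (uniform_dirs f n x)" by blast
    have "?S = Bad \<union> (\<Union>n. uniform_dirs f n x)"
      using lipschitz_dir_in_uniform_dirs[of f x] unfolding Bad_def uniform_dirs_def by blast
    then have "?S = \<Union> (\<N> \<union> range (\<lambda>n. uniform_dirs f n x))"
      using N(3) by auto
    then have "meager_in ?X ?S"
      unfolding meager_in_def using N(1,2) *
      by (intro exI[of _ "\<N> \<union> range (\<lambda>n. uniform_dirs f n x)"]) auto
    \<comment> \<open>Density of the complement, applied to the whole sphere as meager set, puts the
      sphere inside the closure of the empty set.\<close>
    then have "?S \<subseteq> closure (?S - ?S)"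
      by (intro dense_diff_meager) auto
    moreover have "?S \<noteq> {}" by simp
    ultimately show False by simp
  qed
  then obtain n where "\<not> nowhere_dense_in ?X (uniform_dirs f n x)" by blast
  moreover have sub: "uniform_dirs f n x \<subseteq> ?S"
    unfolding uniform_dirs_def by blast
  ultimately obtain u where "u \<in> ?X interior_of (?X closure_of (uniform_dirs f n x))"
    unfolding nowhere_dense_in_def by auto
  then obtain T where T: "openin ?X T" "u \<in> T" "T \<subseteq> ?X closure_of (uniform_dirs f n x)"
    unfolding interior_of_def by blast
  then obtain V where V: "open V" "T = ?S \<inter> V"
    unfolding openin_open by blast
  obtain B where B: "B \<in> \<B>" "u \<in> B" "B \<subseteq> V"
    using topological_basisE[OF assms(2) V(1)] T(2) V(2) by blast
  have "?X closure_of (uniform_dirs f n x) \<subseteq> closure (uniform_dirs f n x)"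
    by (metis closure_of_subtopology_subset euclidean_closure_of)
  then have "B \<inter> ?S \<subseteq> closure (uniform_dirs f n x)"
    using T(3) V(2) B(3) by blast
  moreover have "B \<inter> ?S \<noteq> {}"
    using B T V by blast
  ultimately show thesis
    using that B(1) unfolding piece_def by blast
qed

section \<open>Crossing rays in the plane\<close>

definition det2 :: "real ^ 2 \<Rightarrow> real ^ 2 \<Rightarrow> real" where
  "det2 a b = a $ 1 * b $ 2 - a $ 2 * b $ 1"

lemma det2_cramer:
  assumes "det2 a u \<noteq> 0"
  shows "v = (det2 v u / det2 a u) *\<^sub>R a + (det2 a v / det2 a u) *\<^sub>R u"
proof -
  have "det2 a u * v $ i = det2 v u * a $ i + det2 a v * u $ i" for i
    using exhaust_2[of i] by (auto simp: det2_def algebra_simps)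
  then show ?thesis
    using assms by (simp add: vec_eq_iff divide_simps) (simp add: algebra_simps)
qed

lemma continuous_on_det2 [continuous_intros]:
  assumes "continuous_on A g" "continuous_on A h"
  shows "continuous_on A (\<lambda>x. det2 (g x) (h x))"
  unfolding det2_def by (intro continuous_intros assms)

text \<open>Directions not parallel to \<open>a\<close> form an open set meeting the sphere, so the
  dense set of Lipschitz directions meets it. Transversality is what lets nearby rays cross.\<close>

lemma residual_dirs_transversal:
  fixes f :: "real ^ 2 \<Rightarrow> real"
  assumes "lipschitz_at_residual_dirs f x" and "a \<noteq> 0"
  obtains u where "norm u = 1" "lipschitz_at_dir f x u" "det2 a u \<noteq> 0"
proof -
  let ?S = "sphere (0::real^2) 1"
  define Bad where "Bad = {u \<in> ?S. \<not> lipschitz_at_dir f x u}"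
  have dense: "?S \<subseteq> closure (?S - Bad)"
    using assms(1) unfolding lipschitz_at_residual_dirs_def Bad_def
    by (intro dense_diff_meager) auto
  \<comment> \<open>This is \<open>a\<close> turned by a right angle.\<close>
  define b :: "real^2" where "b = vector [- a $ 2, a $ 1]"
  have "det2 a b = (a $ 1)\<^sup>2 + (a $ 2)\<^sup>2"
    by (simp add: det2_def b_def power2_eq_square)
  moreover have "(a $ 1)\<^sup>2 + (a $ 2)\<^sup>2 \<noteq> 0"
    using assms(2) by (simp add: vec_eq_iff forall_2 sum_power2_eq_zero_iff)
  ultimately have ab: "det2 a b \<noteq> 0" by simp
  then have "b \<noteq> 0" by (auto simp: det2_def)
  have "det2 a (sgn b) = det2 a b / norm b"
    by (simp add: det2_def sgn_div_norm divide_simps)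
  then have "det2 a (sgn b) \<noteq> 0" using ab \<open>b \<noteq> 0\<close> by simp
  moreover have "sgn b \<in> closure (?S - Bad)"
    using dense \<open>b \<noteq> 0\<close> by (auto simp: norm_sgn)
  moreover have "open {u. det2 a u \<noteq> 0}"
    by (intro open_Collect_neq continuous_intros)
  ultimately obtain u where "u \<in> ?S - Bad" "det2 a u \<noteq> 0"
    using open_Int_closure_eq_empty[of "{u. det2 a u \<noteq> 0}" "?S - Bad"] by blast
  then show thesis using that[of u] unfolding Bad_def by auto
qed

text \<open>The direction of \<open>a + t *\<^sub>R u\<close> lies in \<open>B\<close> for small
  \<open>t > 0\<close> and its ray crosses the given one. Crossing at a parameter below \<eta> is an
  open condition on the direction, so some member of \<open>D\<close> satisfies it too.\<close>

lemma crossing_ray: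
  fixes a u :: "real ^ 2"
  assumes au: "det2 a u \<noteq> 0" and B: "open B" "sgn a \<in> B" "B \<inter> sphere 0 1 \<subseteq> closure D"
    and "\<eta> > 0"
  obtains v s h where "v \<in> D" "s > 0" "0 < h" "h < \<eta>" "s *\<^sub>R v = a + h *\<^sub>R u"
proof -
  define \<alpha> where "\<alpha> v = det2 v u / det2 a u" for v
  define \<beta> where "\<beta> v = det2 a v / det2 a u" for v
  have cramer: "v = \<alpha> v *\<^sub>R a + \<beta> v *\<^sub>R u" for v
    unfolding \<alpha>_def \<beta>_def by (rule det2_cramer[OF au])
  have cont: "continuous_on A \<alpha>" "continuous_on A \<beta>" for A
    unfolding \<alpha>_def[abs_def] \<beta>_def[abs_def] using au by (auto intro!: continuous_intros)
  \<comment> \<open>In the basis \<open>a\<close>, \<open>u\<close>, the ray along \<open>v\<close>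
    meets \<open>a + h *\<^sub>R u\<close> at \<open>h = \<beta> v / \<alpha> v\<close>; these
    inequalities say that both rays are followed forwards and \<open>h < \<eta>\<close>.\<close>
  define W where "W = {v. 0 < \<alpha> v} \<inter> {v. 0 < \<beta> v} \<inter> {v. \<beta> v < \<eta> * \<alpha> v}"
  have "open W"
    unfolding W_def by (intro open_Int open_Collect_less continuous_intros cont)
  have "a \<noteq> 0" using au by (auto simp: det2_def)
  have lim: "((\<lambda>t. sgn (a + t *\<^sub>R u)) \<longlongrightarrow> sgn (a + 0 *\<^sub>R u)) (at_right 0)"
    using \<open>a \<noteq> 0\<close> by (intro tendsto_intros) auto
  then have "\<forall>\<^sub>F t in at_right 0. sgn (a + t *\<^sub>R u) \<in> B"
    using topological_tendstoD[OF lim B(1)] B(2) by simp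
  moreover have "\<forall>\<^sub>F t in at_right 0. t \<in> {0<..<\<eta>}"
    using \<open>\<eta> > 0\<close> by (rule eventually_at_right_real)
  ultimately have "\<forall>\<^sub>F t in at_right (0::real). sgn (a + t *\<^sub>R u) \<in> B \<and> t \<in> {0<..<\<eta>}"
    by (rule eventually_conj)
  then obtain t where t: "sgn (a + t *\<^sub>R u) \<in> B" "0 < t" "t < \<eta>"
    by (metis (no_types, lifting) eventually_happens trivial_limit_at_right_real greaterThanLessThan_iff)
  let ?c = "a + t *\<^sub>R u"
  have c: "det2 ?c u = det2 a u" "det2 a ?c = t * det2 a u"
    by (auto simp: det2_def algebra_simps)
  have "?c \<noteq> 0"
  proof
    assume "?c = 0"
    then have "det2 ?c u = 0" by (simp add: det2_def)
    then show False using c(1) au by simp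
  qed
  have coords: "\<alpha> (sgn ?c) = 1 / norm ?c" "\<beta> (sgn ?c) = t / norm ?c"
  proof -
    have "det2 (sgn ?c) u = det2 ?c u / norm ?c" "det2 a (sgn ?c) = det2 a ?c / norm ?c"
      by (simp_all add: det2_def sgn_div_norm divide_simps)
    then show "\<alpha> (sgn ?c) = 1 / norm ?c" "\<beta> (sgn ?c) = t / norm ?c"
      unfolding \<alpha>_def \<beta>_def c using au by auto
  qed
  have "sgn ?c \<in> W"
    using t \<open>?c \<noteq> 0\<close> by (simp add: W_def coords divide_strict_right_mono)
  moreover have "sgn ?c \<in> closure D"
    using B(3) t(1) \<open>?c \<noteq> 0\<close> by (auto simp: norm_sgn)
  ultimately obtain v where v: "v \<in> D" "v \<in> W"
    using open_Int_closure_eq_empty[OF \<open>open W\<close>, of D] by blast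
  show thesis
  proof (rule that[of v "1 / \<alpha> v" "\<beta> v / \<alpha> v"])
    show "(1 / \<alpha> v) *\<^sub>R v = a + (\<beta> v / \<alpha> v) *\<^sub>R u"
      using v(2) by (subst cramer[of v]) (simp add: W_def algebra_simps)
  qed (use v in \<open>auto simp: W_def divide_simps\<close>)
qed

text \<open>The values at \<open>z\<close> and \<open>y\<close> are compared through a crossing
  point. The constant \<open>C\<close> of the ray from \<open>z\<close> is not uniform in
  \<open>z\<close>, but it only enters through \<open>C * h\<close> with \<open>h\<close>
  arbitrarily small.\<close>

lemma piece_lipschitz:
  fixes f :: "real ^ 2 \<Rightarrow> real"
  assumes y: "y \<in> piece f n B" and z: "lipschitz_at_residual_dirs f z"
    and B: "open B" "sgn (z - y) \<in> B" and "z \<noteq> y" and small: "real n * norm (z - y) < 1"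
  shows "\<bar>f z - f y\<bar> \<le> real n * norm (z - y)"
proof -
  obtain u where u: "norm u = 1" "lipschitz_at_dir f z u" "det2 (z - y) u \<noteq> 0"
    using residual_dirs_transversal[OF z, of "z - y"] \<open>z \<noteq> y\<close> by auto
  obtain C b where Cb: "C > 0" "b > 0" "\<And>h. 0 < h \<Longrightarrow> h < b \<Longrightarrow> \<bar>f (z + h *\<^sub>R u) - f z\<bar> \<le> C * h"
    using lipschitz_at_dirD[OF u(2)] by blast
  have dense: "B \<inter> sphere 0 1 \<subseteq> closure (uniform_dirs f n y)"
    using y unfolding piece_def by blast
  show ?thesis
  proof (rule field_le_epsilon)
    fix e :: real assume "e > 0"
    define gap where "gap = 1 - real n * norm (z - y)"
    \<comment> \<open>The three bounds keep \<open>h\<close> within the range valid at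
      \<open>z\<close>, the error \<open>(C + real n) * h\<close> below \<open>e\<close>, and
      \<open>s\<close> within the range of \<open>uniform_dirs f n y\<close>.\<close>
    define \<eta> where "\<eta> = min b (min (e / (C + real n)) (gap / (real n + 1)))"
    have "gap > 0" using small by (simp add: gap_def)
    then have "\<eta> > 0" using Cb \<open>e > 0\<close> by (auto simp: \<eta>_def)
    then obtain v s h where vsh: "v \<in> uniform_dirs f n y" "s > 0" "0 < h" "h < \<eta>"
        "s *\<^sub>R v = z - y + h *\<^sub>R u"
      using crossing_ray[OF u(3) B dense] by blast
    have "norm v = 1" using vsh(1) by (auto simp: uniform_dirs_def)
    then have "s = norm (z - y + h *\<^sub>R u)" using vsh(2,5) by (metis abs_of_pos mult.right_neutral norm_scaleR)
    also have "\<dots> \<le> norm (z - y) + h"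
      using norm_triangle_ineq[of "z - y" "h *\<^sub>R u"] u(1) vsh(3) by simp
    finally have s: "real n * s \<le> real n * norm (z - y) + real n * h"
      by (metis distrib_left mult_left_mono of_nat_0_le_iff)
    have "(real n + 1) * h < gap"
      using vsh(4) by (simp add: \<eta>_def field_simps)
    then have "real n * s < 1"
      using s vsh(3) unfolding gap_def by (simp add: algebra_simps)
    then have "\<bar>f (y + s *\<^sub>R v) - f y\<bar> \<le> real n * s"
      using vsh(1,2) unfolding uniform_dirs_def by blast
    moreover have "y + s *\<^sub>R v = z + h *\<^sub>R u" using vsh(5) by simp
    moreover have "\<bar>f (z + h *\<^sub>R u) - f z\<bar> \<le> C * h"
      using Cb(3) vsh(3,4) by (simp add: \<eta>_def)
    ultimately have "\<bar>f z - f y\<bar> \<le> real n * norm (z - y) + (C + real n) * h"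
      using s by (simp add: algebra_simps)
    also have "h < e / (C + real n)" using vsh(4) by (simp add: \<eta>_def)
    then have "(C + real n) * h < e"
      using Cb(1) by (simp add: pos_less_divide_eq mult.commute add_pos_nonneg)
    finally show "\<bar>f z - f y\<bar> \<le> real n * norm (z - y) + e" by simp
  qed
qed

section \<open>Cones of directions and porosity\<close>

text \<open>Normalising moves \<open>v\<close> by at most its distance to \<open>w\<close>, so the
  distance to \<open>w\<close> at most doubles.\<close>

lemma near_unit_vector:
  fixes v w :: "'a::real_normed_vector"
  assumes "norm w = 1" "norm (v - w) < \<delta> / 2" "\<delta> \<le> 1"
  shows "v \<noteq> 0" "sgn v \<in> ball w \<delta>" "norm v \<le> 2"
proof -
  have v: "\<bar>norm v - 1\<bar> \<le> norm (v - w)"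
    using norm_triangle_ineq3[of v w] assms(1) by simp
  then show "v \<noteq> 0" "norm v \<le> 2" using assms by auto
  have "sgn v - v = (1 - norm v) *\<^sub>R sgn v"
    using \<open>v \<noteq> 0\<close> by (simp add: sgn_div_norm algebra_simps)
  then have "norm (sgn v - v) = \<bar>1 - norm v\<bar>"
    using \<open>v \<noteq> 0\<close> by (simp add: norm_sgn)
  moreover have "norm (sgn v - w) \<le> norm (sgn v - v) + norm (v - w)"
    using norm_triangle_ineq[of "sgn v - v" "v - w"] by simp
  ultimately show "sgn v \<in> ball w \<delta>"
    using v assms(2) by (simp add: dist_norm norm_minus_commute)
qed

text \<open>Dividing \<open>z - y\<close> by \<open>R\<close> gives a vector close to
  \<open>w\<close>. The bound depends on \<open>R\<close> alone, so one \<open>y\<close> can serve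
  two different targets.\<close>

lemma piece_lipschitz_cone:
  fixes f :: "real ^ 2 \<Rightarrow> real"
  assumes "y \<in> piece f n B" "lipschitz_at_residual_dirs f z" "open B"
    and w: "norm w = 1" "ball w \<delta> \<subseteq> B" "\<delta> \<le> 1"
    and R: "R > 0" "real n * (2 * R) < 1" and near: "norm (z - y - R *\<^sub>R w) < R * (\<delta> / 2)"
  shows "\<bar>f z - f y\<bar> \<le> real n * (2 * R)"
proof -
  define v where "v = (z - y) /\<^sub>R R"
  have zy: "z - y = R *\<^sub>R v" using R(1) by (simp add: v_def)
  have "z - y - R *\<^sub>R w = R *\<^sub>R (v - w)" unfolding zy by (simp add: algebra_simps)
  then have "norm (v - w) < \<delta> / 2" using near R(1) by simp
  note v = near_unit_vector[OF w(1) this w(3)]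
  have "sgn (z - y) \<in> B"
    unfolding zy using R(1) v(2) w(2) by (auto simp: sgn_scaleR)
  moreover have "z \<noteq> y" using zy v(1) R(1) by auto
  moreover have "norm (z - y) \<le> 2 * R"
    unfolding zy using v(3) R(1) by simp
  then have le: "real n * norm (z - y) \<le> real n * (2 * R)"
    by (intro mult_left_mono) auto
  ultimately have "\<bar>f z - f y\<bar> \<le> real n * norm (z - y)"
    using R(2) assms(1-3) by (intro piece_lipschitz) auto
  then show ?thesis using le by linarith
qed

lemma lipschitz_at_relativeI:
  assumes "\<rho> > 0" and "\<And>z. z \<in> M \<Longrightarrow> z \<noteq> x \<Longrightarrow> norm (z - x) < \<rho> \<Longrightarrow> \<bar>f z - f x\<bar> \<le> K * norm (z - x)"
  shows "lipschitz_at_relative f x M"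
proof -
  have "\<forall>\<^sub>F z in at x within M. ereal (\<bar>f z - f x\<bar> / norm (z - x)) \<le> ereal K"
    unfolding eventually_at using assms by (auto simp: dist_norm divide_simps intro!: exI[of _ \<rho>])
  then have "Limsup (at x within M) (\<lambda>z. ereal (\<bar>f z - f x\<bar> / norm (z - x))) \<le> ereal K"
    by (rule Limsup_bounded)
  then show ?thesis
    unfolding lipschitz_at_relative_def by auto
qed

text \<open>Stepping back from \<open>x\<close> by \<open>R\<close> against a direction
  \<open>w\<close> in \<open>B\<close> and using non-porosity there yields a point \<open>y\<close>
  of \<open>A\<close> from which both \<open>x\<close> and \<open>z\<close> lie in the cone around
  \<open>w\<close>.\<close>

lemma lipschitz_relative_or_porous:
  fixes f :: "real ^ 2 \<Rightarrow> real"
  assumes "open B" and x: "x \<in> A" "lipschitz_at_residual_dirs f x" and A: "A \<subseteq> piece f n B"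
    and nporous: "\<not> porous_at A x"
  shows "lipschitz_at_relative f x {x. lipschitz_at_residual_dirs f x}"
proof -
  from x A obtain w where w: "w \<in> B" "norm w = 1"
    unfolding piece_def by fastforce
  obtain \<delta>0 where "\<delta>0 > 0" "ball w \<delta>0 \<subseteq> B"
    using assms(1) w(1) open_contains_ball by blast
  define \<delta> where "\<delta> = min 1 \<delta>0"
  have \<delta>: "0 < \<delta>" "\<delta> \<le> 1" "ball w \<delta> \<subseteq> B"
    using \<open>\<delta>0 > 0\<close> \<open>ball w \<delta>0 \<subseteq> B\<close> by (auto simp: \<delta>_def)
  define p where "p = \<delta> / 8"
  have "0 < p" "p < 1" using \<delta> by (auto simp: p_def)
  then obtain \<epsilon> where \<epsilon>: "\<epsilon> > 0"
      "\<And>y. y \<in> ball x \<epsilon> \<Longrightarrow> y \<noteq> x \<Longrightarrow> ball y (p * norm (x - y)) \<inter> A \<noteq> {}"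
    using nporous unfolding porous_at_def by blast
  \<comment> \<open>This makes \<open>norm (z - x) = R * (\<delta> / 4)\<close>; with the error
    \<open>R * (\<delta> / 8)\<close> coming from \<open>p\<close>, the sum stays below
    \<open>R * (\<delta> / 2)\<close>.\<close>
  define t where "t = 4 / \<delta>"
  have "t > 0" using \<delta> by (simp add: t_def)
  \<comment> \<open>The first bound gives \<open>R < \<epsilon>\<close>, the second
    \<open>real n * (2 * R) < 1\<close>; the summand 1 covers \<open>n = 0\<close>.\<close>
  define \<rho> where "\<rho> = min (\<epsilon> / t) (1 / (2 * t * (real n + 1)))"
  show ?thesis
  proof (rule lipschitz_at_relativeI[of \<rho> _ _ _ "4 * real n * t"])
    show "\<rho> > 0" using \<epsilon>(1) \<open>t > 0\<close> by (simp add: \<rho>_def)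
    fix z assume z: "z \<in> {x. lipschitz_at_residual_dirs f x}" "z \<noteq> x" "norm (z - x) < \<rho>"
    define R where "R = t * norm (z - x)"
    have "R > 0" using z(2) \<open>t > 0\<close> by (simp add: R_def)
    have "R < \<epsilon>"
      using z(3) \<open>t > 0\<close> by (simp add: R_def \<rho>_def field_simps)
    have "norm (z - x) < 1 / (2 * t * (real n + 1))"
      using z(3) by (simp add: \<rho>_def)
    then have "norm (z - x) * (2 * t * (real n + 1)) < 1"
      using \<open>t > 0\<close> by (subst (asm) pos_less_divide_eq) (auto intro!: mult_pos_pos)
    then have "(real n + 1) * (2 * R) < 1"
      by (simp add: R_def algebra_simps)
    then have small: "real n * (2 * R) < 1"
      using \<open>R > 0\<close> by (simp add: algebra_simps)
    have Rz: "norm (z - x) = R * (\<delta> / 4)"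
      using \<delta> by (simp add: R_def t_def)
    have "x - R *\<^sub>R w \<in> ball x \<epsilon>" "x - R *\<^sub>R w \<noteq> x" "norm (x - (x - R *\<^sub>R w)) = R"
      using w \<open>R > 0\<close> \<open>R < \<epsilon>\<close> by (auto simp: dist_norm)
    then obtain y where y: "y \<in> A" "norm (x - R *\<^sub>R w - y) < p * R"
      using \<epsilon>(2)[of "x - R *\<^sub>R w"] by (auto simp: dist_norm)
    have near: "norm (x - y - R *\<^sub>R w) < R * (\<delta> / 8)"
      using y(2) by (simp add: p_def algebra_simps)
    have "norm (z - y - R *\<^sub>R w) \<le> norm (z - x) + norm (x - y - R *\<^sub>R w)"
      using norm_triangle_ineq[of "z - x" "x - y - R *\<^sub>R w"] by (simp add: algebra_simps)
    also have "\<dots> < R * (\<delta> / 4) + R * (\<delta> / 8)"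
      using Rz near by simp
    also have "\<dots> < R * (\<delta> / 2)"
      using \<open>R > 0\<close> \<delta>(1) by (simp add: field_simps)
    finally have near_z: "norm (z - y - R *\<^sub>R w) < R * (\<delta> / 2)" .
    have "R * (\<delta> / 8) < R * (\<delta> / 2)"
      using \<open>R > 0\<close> \<delta>(1) by simp
    then have near_x: "norm (x - y - R *\<^sub>R w) < R * (\<delta> / 2)"
      using near by linarith
    note cone = piece_lipschitz_cone[OF subsetD[OF A y(1)] _ \<open>open B\<close> w(2) \<delta>(3,2) \<open>R > 0\<close> small]
    have "\<bar>f z - f y\<bar> \<le> real n * (2 * R)" "\<bar>f x - f y\<bar> \<le> real n * (2 * R)"
      using cone[OF _ near_z] cone[OF _ near_x] z(1) x(2) by auto
    then have "\<bar>f z - f x\<bar> \<le> 4 * real n * R" by linarith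
    then show "\<bar>f z - f x\<bar> \<le> 4 * real n * t * norm (z - x)"
      by (simp add: R_def mult.assoc)
  qed
qed

theorem theorem1:
  fixes f :: "real ^ 2 \<Rightarrow> real"
    and E F :: "(real ^ 2) set"
  assumes E_eq: "E = {x. lipschitz_at_residual_dirs f x}"
    and F_eq: "F = {x \<in> E. \<not> lipschitz_at_relative f x E}"
  shows "sigma_porous F"
proof -
  obtain \<B> :: "(real ^ 2) set set" where \<B>: "countable \<B>" "topological_basis \<B>"
    using ex_countable_basis by blast
  let ?P = "(\<lambda>(n, B). F \<inter> piece f n B) ` (UNIV \<times> \<B>)"
  \<comment> \<open>A point of non-porosity would be one where \<open>f\<close> is Lipschitz
    relative to \<open>E\<close>, contrary to membership in \<open>F\<close>.\<close>
  have "porous (F \<inter> piece f n B)" if "B \<in> \<B>" for n B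
    unfolding porous_def
    using lipschitz_relative_or_porous[of B _ "F \<inter> piece f n B" f n]
      topological_basis_open[OF \<B>(2) that] E_eq F_eq by blast
  moreover have "F = \<Union> ?P"
  proof
    show "F \<subseteq> \<Union> ?P"
    proof
      fix x assume "x \<in> F"
      then have "lipschitz_at_residual_dirs f x" using E_eq F_eq by simp
      then obtain n B where "B \<in> \<B>" "x \<in> piece f n B"
        using residual_dirs_in_piece \<B>(2) by blast
      then show "x \<in> \<Union> ?P" using \<open>x \<in> F\<close> by blast
    qed
  qed auto
  moreover have "countable ?P" using \<B>(1) by simp
  ultimately show ?thesis
    unfolding sigma_porous_def by (intro exI[of _ ?P]) auto
qed

end
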